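(* Let $m_1,\ldots,m_k$ be positive integers. For exact $k$-typed parking functions $\alpha$ of order $(m_1,\ldots,m_k)$, there is a one-to-one correspondence between generative multisets $GM(\alpha)$ and families $\mathrm{fam}(\alpha)$: the assignment $\mathrm{fam}(\alpha)\mapsto GM(\alpha)$ is a well-defined bijection from the set of families of exact $k$-TPFs of order $(m_1,\ldots,m_k)$ onto the set of generative multisets of exact $k$-TPFs of order $(m_1,\ldots,m_k)$.
   Context: Let $M=m_1+\cdots+m_k$. There are $M$ cars, $m_i$ of them of type $i$, and $M$ parking spots in a row. Consider tuples $\alpha=(m_1;P_2,\ldots,P_k)$, where each $P_i=(p^{(i)}_1,\ldots,p^{(i)}_{m_i})$ is an ordered list of nonnegative integers (for $k=1$, $\alpha=(m_1)$). Such an $\alpha$ is an exact $k$-typed parking function (exact $k$-TPF) of order $(m_1,\ldots,m_k)$ if there is an arrangement of the $M$ cars in the $M$ spots, one car per spot, such that for all $2\le i\le k$ and $1\le j\le m_i$ the $j$-th car of type $i$ has exactly $p^{(i)}_j$ cars of types in $\{1,\ldots,i-1\}$ parked before it. An exact $k$-TPF $\beta=(m_1;Q_2,\ldots,Q_k)$ is a parking permutation of $\alpha=(m_1;P_2,\ldots,P_k)$ if for every $i=2,\ldots,k$ the list $Q_i$ is a rearrangement of the list $P_i$. The family $\mathrm{fam}(\alpha)$ is the set of all parking permutations of $\alpha$ (including $\alpha$ itself). With $\mu_i=\sum_{j=1}^{i-1}m_j$, put $\mathrm{mult}(P_i)=\{(0,a_{i_0}),(1,a_{i_1}),\ldots,(\mu_i,a_{i_{\mu_i}})\}$,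 where $a_{i_j}$ is the number of entries of $P_i$ equal to $j$ (pairs with $a_{i_j}=0$ are kept). The generative multiset of $\alpha$ is the set $GM(\alpha)=\{\mathrm{mult}(P_2),\mathrm{mult}(P_3),\ldots,\mathrm{mult}(P_k)\}$. *)

theory Defs
  imports Main "HOL-Library.Multiset"
begin

text \<open>
  A tuple \<open>(m\<^sub>1; P\<^sub>2, \<dots>, P\<^sub>k)\<close> is encoded as the pair of \<open>m\<^sub>1\<close> and the list of lists
  \<open>[P\<^sub>2, \<dots>, P\<^sub>k]\<close>; for \<open>k = 1\<close> the second component is empty. The tuple determines \<open>k\<close>
  and its order \<open>(m\<^sub>1, \<dots>, m\<^sub>k)\<close>. Types, cars of a given type and parking spots are numbered
  from 1, whereas list positions start at 0.
\<close>

type_synonym typed_tuple = "nat \<times> nat list list"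

definition tpf_order :: "typed_tuple \<Rightarrow> nat list" where
  "tpf_order \<alpha> = fst \<alpha> # map length (snd \<alpha>)"

definition num_types :: "typed_tuple \<Rightarrow> nat" where
  "num_types \<alpha> = length (tpf_order \<alpha>)"

definition num_cars :: "typed_tuple \<Rightarrow> nat \<Rightarrow> nat" where
  "num_cars \<alpha> i = tpf_order \<alpha> ! (i - 1)"

text \<open>The list \<open>P\<^sub>i\<close>, meaningful for \<open>2 \<le> i \<le> k\<close> only.\<close>

definition pref_list :: "typed_tuple \<Rightarrow> nat \<Rightarrow> nat list" where
  "pref_list \<alpha> i = snd \<alpha> ! (i - 2)"

text \<open>The pair \<open>(i, j)\<close> is the \<open>j\<close>-th car of type \<open>i\<close>.\<close>

definition cars :: "typed_tuple \<Rightarrow> (nat \<times> nat) set" where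
  "cars \<alpha> = (SIGMA i:{1..num_types \<alpha>}. {1..num_cars \<alpha> i})"

definition is_arrangement :: "typed_tuple \<Rightarrow> (nat \<times> nat \<Rightarrow> nat) \<Rightarrow> bool" where
  "is_arrangement \<alpha> spot \<longleftrightarrow> bij_betw spot (cars \<alpha>) {1..sum_list (tpf_order \<alpha>)}"

definition exact_tpf :: "typed_tuple \<Rightarrow> bool" where
  "exact_tpf \<alpha> \<longleftrightarrow> (\<exists>spot. is_arrangement \<alpha> spot \<and>
     (\<forall>i\<in>{2..num_types \<alpha>}. \<forall>j\<in>{1..num_cars \<alpha> i}.
        card {c \<in> cars \<alpha>. fst c < i \<and> spot c < spot (i, j)} = pref_list \<alpha> i ! (j - 1)))"

definition exact_tpfs :: "nat list \<Rightarrow> typed_tuple set" where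
  "exact_tpfs ms = {\<alpha>. exact_tpf \<alpha> \<and> tpf_order \<alpha> = ms}"

definition parking_permutation :: "typed_tuple \<Rightarrow> typed_tuple \<Rightarrow> bool" where
  "parking_permutation \<alpha> \<beta> \<longleftrightarrow> exact_tpf \<beta> \<and> fst \<beta> = fst \<alpha> \<and> num_types \<beta> = num_types \<alpha> \<and>
     (\<forall>i\<in>{2..num_types \<alpha>}. mset (pref_list \<beta> i) = mset (pref_list \<alpha> i))"

definition fam :: "typed_tuple \<Rightarrow> typed_tuple set" where
  "fam \<alpha> = {\<beta>. parking_permutation \<alpha> \<beta>}"

definition lower_cars :: "typed_tuple \<Rightarrow> nat \<Rightarrow> nat" where
  "lower_cars \<alpha> i = (\<Sum>j\<in>{1..i - 1}. num_cars \<alpha> j)"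

definition mult_pairs :: "typed_tuple \<Rightarrow> nat \<Rightarrow> (nat \<times> nat) set" where
  "mult_pairs \<alpha> i = (\<lambda>j. (j, count_list (pref_list \<alpha> i) j)) ` {0..lower_cars \<alpha> i}"

text \<open>
  Despite its name, the generative multiset is a plain set of sets, not indexed by the type:
  the type to which each member belongs is not recorded.
\<close>

definition GM :: "typed_tuple \<Rightarrow> (nat \<times> nat) set set" where
  "GM \<alpha> = mult_pairs \<alpha> ` {2..num_types \<alpha>}"

end

theory Submission imports Defs begin

text \<open>
  Both the family and the generative multiset of an exact typed parking function of fixed order
  carry the same information, namely the multiset of entries of every list \<open>P\<^sub>i\<close>.

  For families this holds because an exact typed parking function belongs to its own family, and
  membership in a family is a condition on these multisets (\<open>fam_eq_iff_mset_eq\<close>).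

  For the generative multiset two things have to be checked. First, \<open>mult(P\<^sub>i)\<close> determines the
  multiset of \<open>P\<^sub>i\<close> although it tabulates only the values \<open>0, \<dots>, \<mu>\<^sub>i\<close>: an entry of \<open>P\<^sub>i\<close> counts
  some of the \<open>\<mu>\<^sub>i\<close> cars of smaller type, so no value is missed (\<open>pref_le_lower_cars\<close>). Secondly,
  although \<open>GM(\<alpha>)\<close> forgets which member comes from which type, the type can be read off: the
  first components of \<open>mult(P\<^sub>i)\<close> are exactly \<open>0, \<dots>, \<mu>\<^sub>i\<close>, and \<open>\<mu>\<^sub>2 < \<mu>\<^sub>3 < \<dots>\<close> since all \<open>m\<^sub>i\<close> are
  positive (\<open>inj_on_lower_cars\<close>).
\<close>

text \<open>
  Two labellings with the same kernel are translated into each other by choosing a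
  representative of each class; \<open>\<Phi> (f x) = g x\<close> says that the choice does not matter.
\<close>

lemma ex_bij_betw_images:
  assumes "\<And>x y. x \<in> A \<Longrightarrow> y \<in> A \<Longrightarrow> f x = f y \<longleftrightarrow> g x = g y"
  shows "\<exists>\<Phi>. (\<forall>x\<in>A. \<Phi> (f x) = g x) \<and> bij_betw \<Phi> (f ` A) (g ` A)"
proof -
  define \<Phi> where "\<Phi> = (\<lambda>y. g (inv_into A f y))"
  have \<Phi>: "\<Phi> (f x) = g x" if "x \<in> A" for x
    unfolding \<Phi>_def using that assms[of "inv_into A f (f x)" x]
    by (simp add: f_inv_into_f inv_into_into)
  have "inj_on \<Phi> (f ` A)"
    using assms by (auto simp: inj_on_def \<Phi>)
  moreover have "\<Phi> ` f ` A = g ` A"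
    using \<Phi> by (auto simp: image_iff)
  ultimately show ?thesis
    using \<Phi> by (auto simp: bij_betw_def)
qed

lemma lower_cars_cong: "tpf_order \<alpha> = tpf_order \<beta> \<Longrightarrow> lower_cars \<alpha> i = lower_cars \<beta> i"
  by (simp add: lower_cars_def num_cars_def)

lemma length_pref_list:
  assumes "i \<in> {2..num_types \<alpha>}"
  shows "length (pref_list \<alpha> i) = num_cars \<alpha> i"
proof -
  obtain n where "i = Suc (Suc n)"
    using assms by (metis Suc_le_D atLeastAtMost_iff numeral_2_eq_2 Suc_le_mono)
  then show ?thesis
    using assms by (simp add: num_types_def tpf_order_def num_cars_def pref_list_def)
qed

text \<open>
  The cars counted by an entry of \<open>P\<^sub>i\<close> all have a type below \<open>i\<close>, and there are only
  \<open>\<mu>\<^sub>i\<close> of these.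
\<close>

lemma pref_le_lower_cars:
  assumes "exact_tpf \<alpha>" "i \<in> {2..num_types \<alpha>}" "x \<in> set (pref_list \<alpha> i)"
  shows "x \<le> lower_cars \<alpha> i"
proof -
  obtain spot :: "nat \<times> nat \<Rightarrow> nat" where spot: "\<forall>i\<in>{2..num_types \<alpha>}. \<forall>j\<in>{1..num_cars \<alpha> i}.
      card {c \<in> cars \<alpha>. fst c < i \<and> spot c < spot (i, j)} = pref_list \<alpha> i ! (j - 1)"
    using assms(1) unfolding exact_tpf_def by blast
  obtain n where n: "n < num_cars \<alpha> i" "x = pref_list \<alpha> i ! n"
    using assms(2,3) by (auto simp: in_set_conv_nth length_pref_list)
  have "x = card {c \<in> cars \<alpha>. fst c < i \<and> spot c < spot (i, Suc n)}"
    using spot[rule_format, OF assms(2), of "Suc n"] n by simp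
  also have "\<dots> \<le> card (SIGMA j:{1..i - 1}. {1..num_cars \<alpha> j})"
    by (rule card_mono) (auto simp: cars_def)
  also have "\<dots> = lower_cars \<alpha> i"
    by (simp add: lower_cars_def)
  finally show ?thesis .
qed

text \<open>
  Positivity of the \<open>m\<^sub>i\<close> enters here: an empty type \<open>i\<close> would give \<open>\<mu>\<^sub>i = \<mu>\<^sub>i\<^sub>+\<^sub>1\<close>.
\<close>

lemma inj_on_lower_cars:
  assumes pos: "\<forall>m\<in>set (tpf_order \<alpha>). 0 < m"
  shows "inj_on (lower_cars \<alpha>) {2..num_types \<alpha>}"
proof -
  have less: "lower_cars \<alpha> i < lower_cars \<alpha> j"
    if "2 \<le> i" "i < j" "j \<le> num_types \<alpha>" for i j
  proof -
    have "0 < num_cars \<alpha> i"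
      using that pos by (auto simp: num_cars_def num_types_def)
    then show ?thesis
      unfolding lower_cars_def by (rule sum_strict_mono2[rotated 3]) (use that in auto)
  qed
  show ?thesis
    by (rule linorder_inj_onI) (use less in \<open>fastforce+\<close>)
qed

lemma fst_image_mult_pairs: "fst ` mult_pairs \<alpha> i = {0..lower_cars \<alpha> i}"
  by (simp add: mult_pairs_def image_image)

text \<open>
  Up to \<open>\<mu>\<^sub>i\<close> the multiplicities are recorded in \<open>mult(P\<^sub>i)\<close>; beyond \<open>\<mu>\<^sub>i\<close> they all vanish
  by \<open>pref_le_lower_cars\<close>.
\<close>

lemma mult_pairs_eq_iff_mset_eq:
  assumes "exact_tpf \<alpha>" "exact_tpf \<beta>" "tpf_order \<alpha> = tpf_order \<beta>" "i \<in> {2..num_types \<alpha>}"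
  shows "mult_pairs \<alpha> i = mult_pairs \<beta> i \<longleftrightarrow> mset (pref_list \<alpha> i) = mset (pref_list \<beta> i)"
proof
  assume eq: "mult_pairs \<alpha> i = mult_pairs \<beta> i"
  have le: "lower_cars \<alpha> i = lower_cars \<beta> i" "i \<in> {2..num_types \<beta>}"
    using assms(3,4) by (auto simp: num_types_def intro: lower_cars_cong)
  show "mset (pref_list \<alpha> i) = mset (pref_list \<beta> i)"
  proof (rule multiset_eqI)
    fix x
    show "count (mset (pref_list \<alpha> i)) x = count (mset (pref_list \<beta> i)) x"
    proof (cases "x \<le> lower_cars \<alpha> i")
      case True
      then have "(x, count_list (pref_list \<alpha> i) x) \<in> mult_pairs \<beta> i"
        unfolding eq[symmetric] by (auto simp: mult_pairs_def)
      then show ?thesis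
        by (auto simp: mult_pairs_def count_mset)
    next
      case False
      then have "x \<notin> set (pref_list \<alpha> i)" "x \<notin> set (pref_list \<beta> i)"
        using pref_le_lower_cars assms le by metis+
      then show ?thesis
        by (metis count_eq_zero_iff set_mset_mset)
    qed
  qed
next
  assume "mset (pref_list \<alpha> i) = mset (pref_list \<beta> i)"
  then have "count_list (pref_list \<alpha> i) = count_list (pref_list \<beta> i)"
    by (metis count_mset ext)
  then show "mult_pairs \<alpha> i = mult_pairs \<beta> i"
    using lower_cars_cong[OF assms(3)] by (simp add: mult_pairs_def)
qed

text \<open>
  The unindexed set \<open>GM(\<alpha>)\<close> is as good as the indexed family of its members: a member
  \<open>mult(P\<^sub>i)\<close> of one can only coincide with a member \<open>mult(Q\<^sub>j)\<close> of the other if their ranges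
  \<open>{0..\<mu>\<^sub>i}\<close> and \<open>{0..\<mu>\<^sub>j}\<close> of first components agree, which forces \<open>i = j\<close>.
\<close>

lemma GM_eq_iff_mult_pairs_eq:
  assumes "tpf_order \<alpha> = tpf_order \<beta>" and pos: "\<forall>m\<in>set (tpf_order \<alpha>). 0 < m"
  shows "GM \<alpha> = GM \<beta> \<longleftrightarrow> (\<forall>i\<in>{2..num_types \<alpha>}. mult_pairs \<alpha> i = mult_pairs \<beta> i)"
proof
  have types: "num_types \<beta> = num_types \<alpha>"
    using assms(1) by (simp add: num_types_def)
  assume eq: "GM \<alpha> = GM \<beta>"
  show "\<forall>i\<in>{2..num_types \<alpha>}. mult_pairs \<alpha> i = mult_pairs \<beta> i"
  proof
    fix i assume i: "i \<in> {2..num_types \<alpha>}"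
    then have "mult_pairs \<alpha> i \<in> GM \<beta>"
      unfolding eq[symmetric] by (simp add: GM_def)
    then obtain j where j: "j \<in> {2..num_types \<alpha>}" "mult_pairs \<alpha> i = mult_pairs \<beta> j"
      by (auto simp: GM_def types)
    then have "{0..lower_cars \<alpha> i} = {0..lower_cars \<alpha> j}"
      by (metis fst_image_mult_pairs lower_cars_cong[OF assms(1)])
    then have "lower_cars \<alpha> i = lower_cars \<alpha> j"
      by simp
    then have "i = j"
      using inj_on_lower_cars[OF pos] i j(1) by (auto dest: inj_onD)
    then show "mult_pairs \<alpha> i = mult_pairs \<beta> i"
      using j(2) by simp
  qed
next
  assume "\<forall>i\<in>{2..num_types \<alpha>}. mult_pairs \<alpha> i = mult_pairs \<beta> i"
  then show "GM \<alpha> = GM \<beta>"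
    using assms(1) by (simp add: GM_def num_types_def)
qed

text \<open>
  Being a parking permutation of \<open>\<alpha>\<close> depends on \<open>\<alpha>\<close> only through its order and the multisets
  of its lists; conversely \<open>\<alpha>\<close>, as a member of its own family, exhibits these multisets.
\<close>

lemma fam_eq_iff_mset_eq:
  assumes "exact_tpf \<alpha>" "tpf_order \<alpha> = tpf_order \<beta>"
  shows "fam \<alpha> = fam \<beta> \<longleftrightarrow>
    (\<forall>i\<in>{2..num_types \<alpha>}. mset (pref_list \<alpha> i) = mset (pref_list \<beta> i))"
proof -
  have same: "num_types \<beta> = num_types \<alpha>" "fst \<beta> = fst \<alpha>"
    using assms(2) by (auto simp: num_types_def tpf_order_def)
  have "\<alpha> \<in> fam \<alpha>"
    using assms(1) by (simp add: fam_def parking_permutation_def)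
  moreover have "\<alpha> \<in> fam \<beta> \<Longrightarrow>
      \<forall>i\<in>{2..num_types \<alpha>}. mset (pref_list \<alpha> i) = mset (pref_list \<beta> i)"
    by (simp add: fam_def parking_permutation_def same)
  moreover have "\<forall>i\<in>{2..num_types \<alpha>}. mset (pref_list \<alpha> i) = mset (pref_list \<beta> i) \<Longrightarrow>
      fam \<alpha> = fam \<beta>"
    by (simp add: fam_def parking_permutation_def same)
  ultimately show ?thesis
    by blast
qed

theorem corollary5p6:
  fixes ms :: "nat list"
  assumes "ms \<noteq> []"
    and "\<forall>m\<in>set ms. 0 < m"
  shows "\<exists>\<Phi>. (\<forall>\<alpha>\<in>exact_tpfs ms. \<Phi> (fam \<alpha>) = GM \<alpha>) \<and>
           bij_betw \<Phi> (fam ` exact_tpfs ms) (GM ` exact_tpfs ms)"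
proof (rule ex_bij_betw_images)
  fix \<alpha> \<beta> assume "\<alpha> \<in> exact_tpfs ms" "\<beta> \<in> exact_tpfs ms"
  then have \<alpha>\<beta>: "exact_tpf \<alpha>" "exact_tpf \<beta>" "tpf_order \<alpha> = tpf_order \<beta>"
    and pos: "\<forall>m\<in>set (tpf_order \<alpha>). 0 < m"
    using assms(2) by (simp_all add: exact_tpfs_def)
  show "fam \<alpha> = fam \<beta> \<longleftrightarrow> GM \<alpha> = GM \<beta>"
    using fam_eq_iff_mset_eq[OF \<alpha>\<beta>(1,3)] GM_eq_iff_mult_pairs_eq[OF \<alpha>\<beta>(3) pos]
      mult_pairs_eq_iff_mset_eq[OF \<alpha>\<beta>] by simp
qed

end
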